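(* Let $\alpha\in\mathbb C\setminus\{-1,-2,\dots\}$, $M\in\mathbb N$, $c_1,\dots,c_M\in\mathbb R$, $\mu_1,\dots,\mu_M\in\mathbb C$, and $\nu_1\le\nu_2\le\dots\le\nu_M$ in $\mathbb N_0$. Let $\mathbf u_\alpha$ be the Laguerre functional, and assume that the sequence $(L_n^{\alpha,\vec\mu}(x))_{n\ge 0}$ of orthogonal polynomials with respect to $$\langle f,g\rangle=\langle \mathbf u_\alpha, fg\rangle+\sum_{j=1}^M\mu_j f^{(\nu_j)}(c_j)\,g^{(\nu_j)}(c_j)$$ exists. Let $\zeta(x)$ be a nonzero polynomial of minimal degree such that $(\zeta L_n^{\alpha,\vec\mu})^{(\nu_j)}(c_j)=0$ for all $j=1,\dots,M$ and all $n\in\mathbb N_0$, and let $\nu=\deg\zeta$. Let $(\zeta_j(x))_{j=0}^{\nu}$ be a sequence of polynomials with $\zeta_\nu=\zeta$, $\deg\zeta_k=k$ for $k=0,\dots,\nu$, and $\zeta_k$ a divisor of $\zeta_{k+1}$ for $k=0,1,\dots,\nu-1$. For $j=0,1,\dots,\nu$, let $(P_n^{[\zeta_j^2]}(x))_{n\ge 0}$ be the polynomials orthogonal with respect to the linear functional $|\zeta_j(x)|^2\mathbf u_\alpha$ (assumed to exist), and write $P_n=P_n^{[\zeta_0^2]}$, which is a nonzero multiple of the Laguerre polynomial $L_n^{\alpha}$. Suppose that for every $n\ge\nu$ $$P_n(c_j)\,P_{n-1}^{[\zeta_1^2]}(c_j)\cdots P_{n-\nu}^{[\zeta_\nu^2]}(c_j)\neq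 0,\qquad j=1,2,\dots,M.$$ Then, for every $n\ge \nu$, there exist coefficients $\lambda_{0,n},\lambda_{1,n},\dots,\lambda_{\nu,n}\in\mathbb C$, not all zero, such that $$L_n^{\alpha,\vec\mu}(x)=\sum_{j=0}^{\nu}\lambda_{j,n}\,\zeta_j(x)\,P_{n-j}^{[\zeta_j^2]}(x).$$
   Context: $\mathbb N_0=\{0,1,2,\dots\}$. Polynomials have complex coefficients, and a linear functional $\mathbf u$ is an element of the algebraic dual of the space of polynomials, with duality bracket $\langle\mathbf u,p\rangle$. For a polynomial $q$, the functional $q\mathbf u$ is defined by $\langle q\mathbf u,p\rangle=\langle\mathbf u,qp\rangle$. The Laguerre functional $\mathbf u_\alpha$ is a nonzero linear functional satisfying the Pearson equation $\frac{d}{dx}[x\,\mathbf u_\alpha]=(\alpha+1-x)\mathbf u_\alpha$, i.e. $-\langle\mathbf u_\alpha,x p'(x)\rangle=\langle\mathbf u_\alpha,(\alpha+1-x)p(x)\rangle$ for all polynomials $p$. It is determined up to a nonzero constant factor (its normalization is immaterial here), and its moments satisfy $\langle\mathbf u_\alpha,x^{n+1}\rangle=(n+\alpha+1)\langle\mathbf u_\alpha,x^n\rangle$. When $\Re\alpha>-1$ it is, up to a constant, $\langle\mathbf u_\alpha,f\rangle=\int_0^\infty f(x)x^\alpha e^{-x}\,dx$. The Laguerre polynomials are $L_n^\alpha(x)=\frac{(\alpha+1)_n}{n!}\,{}_1F_1(-n;\alpha+1;x)$, where $(a)_n=a(a+1)\cdots(a+n-1)$. A sequence $(Q_n)_{n\ge0}$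 is orthogonal with respect to a linear functional $\mathbf v$ if $\deg Q_n=n$, $\langle\mathbf v,Q_nQ_m\rangle=0$ for $m\ne n$, and $\langle\mathbf v,Q_n^2\rangle\neq0$ for all $n$. Similarly, $(L_n^{\alpha,\vec\mu})_{n\ge 0}$ being orthogonal with respect to the symmetric bilinear form $\langle\cdot,\cdot\rangle$ means $\deg L_n^{\alpha,\vec\mu}=n$, $\langle L_n^{\alpha,\vec\mu},L_m^{\alpha,\vec\mu}\rangle=0$ for $m\neq n$, and $\langle L_n^{\alpha,\vec\mu},L_n^{\alpha,\vec\mu}\rangle\ne0$ for all $n$; it is normalized so that $L_n^{\alpha,\vec\mu}$ has the same leading coefficient as $L_n^{\alpha}$. $|\zeta_j(x)|^2$ denotes the polynomial $\zeta_j(x)\overline{\zeta_j}(x)$, where $\overline{\zeta_j}$ is obtained from $\zeta_j$ by conjugating its coefficients (so it agrees with $|\zeta_j(x)|^2$ for real $x$). *)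

theory Defs
  imports Complex_Main "HOL-Computational_Algebra.Polynomial"
begin

type_synonym functional = "complex poly \<Rightarrow> complex"

definition linear_functional :: "functional \<Rightarrow> bool" where
  "linear_functional u \<longleftrightarrow> Vector_Spaces.linear smult (*) u"

text \<open>The functionals \<open>q u\<close> and \<open>du/dx\<close>, by duality.\<close>

definition mult_functional :: "complex poly \<Rightarrow> functional \<Rightarrow> functional" where
  "mult_functional q u = (\<lambda>p. u (q * p))"

definition deriv_functional :: "functional \<Rightarrow> functional" where
  "deriv_functional u = (\<lambda>p. - u (pderiv p))"

text \<open>The Laguerre functional is determined by the Pearson equation only up to a nonzero
  factor, so it is a predicate.\<close>

definition laguerre_functional :: "complex \<Rightarrow> functional \<Rightarrow> bool" where
  "laguerre_functional \<alpha> u \<longleftrightarrow>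
     linear_functional u \<and> u \<noteq> (\<lambda>p. 0) \<and>
     deriv_functional (mult_functional [:0, 1:] u) = mult_functional [:\<alpha> + 1, -1:] u"

text \<open>The series for \<open>1F1(-n; \<alpha>+1; x)\<close> terminates at \<open>k = n\<close>, because
  \<open>pochhammer (- of_nat n) k = 0\<close> for \<open>k > n\<close>.\<close>

definition laguerre_poly :: "complex \<Rightarrow> nat \<Rightarrow> complex poly" where
  "laguerre_poly \<alpha> n =
     smult (pochhammer (\<alpha> + 1) n / fact n)
       (\<Sum>k\<le>n. monom (pochhammer (- of_nat n) k / (pochhammer (\<alpha> + 1) k * fact k)) k)"

text \<open>Since \<open>degree 0 = 0\<close>, degree conditions come with an explicit \<open>\<noteq> 0\<close>.\<close>

definition orthogonal_wrt_form ::
    "(complex poly \<Rightarrow> complex poly \<Rightarrow> complex) \<Rightarrow> (nat \<Rightarrow> complex poly) \<Rightarrow> bool" where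
  "orthogonal_wrt_form B Q \<longleftrightarrow>
     (\<forall>n. Q n \<noteq> 0 \<and> degree (Q n) = n) \<and>
     (\<forall>n m. m \<noteq> n \<longrightarrow> B (Q n) (Q m) = 0) \<and>
     (\<forall>n. B (Q n) (Q n) \<noteq> 0)"

definition orthogonal_wrt :: "functional \<Rightarrow> (nat \<Rightarrow> complex poly) \<Rightarrow> bool" where
  "orthogonal_wrt v Q \<longleftrightarrow> orthogonal_wrt_form (\<lambda>f g. v (f * g)) Q"

text \<open>\<open>p^(k)(c)\<close> at a real point \<open>c\<close>.\<close>

definition deriv_at :: "nat \<Rightarrow> complex poly \<Rightarrow> real \<Rightarrow> complex" where
  "deriv_at k p c = poly ((pderiv ^^ k) p) (complex_of_real c)"

text \<open>The families \<open>\<mu>\<close>, \<open>c\<close>, \<open>\<nu>\<close> are indexed by \<open>{1..M}\<close>; values outside it are irrelevant.\<close>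

definition sobolev_form ::
    "functional \<Rightarrow> nat \<Rightarrow> (nat \<Rightarrow> complex) \<Rightarrow> (nat \<Rightarrow> real) \<Rightarrow> (nat \<Rightarrow> nat) \<Rightarrow>
     complex poly \<Rightarrow> complex poly \<Rightarrow> complex" where
  "sobolev_form u M \<mu> c \<nu> f g =
     u (f * g) + (\<Sum>j=1..M. \<mu> j * deriv_at (\<nu> j) f (c j) * deriv_at (\<nu> j) g (c j))"

definition sobolev_laguerre ::
    "complex \<Rightarrow> functional \<Rightarrow> nat \<Rightarrow> (nat \<Rightarrow> complex) \<Rightarrow> (nat \<Rightarrow> real) \<Rightarrow> (nat \<Rightarrow> nat) \<Rightarrow>
     (nat \<Rightarrow> complex poly) \<Rightarrow> bool" where
  "sobolev_laguerre \<alpha> u M \<mu> c \<nu> L \<longleftrightarrow>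
     orthogonal_wrt_form (sobolev_form u M \<mu> c \<nu>) L \<and>
     (\<forall>n. lead_coeff (L n) = lead_coeff (laguerre_poly \<alpha> n))"

text \<open>The polynomial \<open>|p(x)|^2\<close>, which agrees with the squared modulus for real \<open>x\<close>.\<close>

definition abs_square_poly :: "complex poly \<Rightarrow> complex poly" where
  "abs_square_poly p = p * map_poly cnj p"

end

theory Submission
  imports Defs "HOL-Computational_Algebra.Fundamental_Theorem_Algebra"
begin

text \<open>
  The minimal polynomial \<open>\<zeta>\<close> has all its roots among the real points \<open>c\<^sub>j\<close>, so every
  \<open>\<zeta>\<^sub>k\<close> equals its conjugate up to a constant and \<open>|\<zeta>\<^sub>k|\<^sup>2\<close> may be replaced by \<open>\<zeta>\<^sub>k\<^sup>2\<close>.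
  By the nonvanishing hypothesis, \<open>\<lambda>\<^sub>0, \<lambda>\<^sub>1, \<dots>\<close> can be chosen one after the other such that
  \<open>L\<^sub>n - (\<Sum>j<k. \<lambda>\<^sub>j \<zeta>\<^sub>j P\<^sub>j)\<close> is divisible by \<open>\<zeta>\<^sub>k\<close>: the root gained in passing from
  \<open>\<zeta>\<^sub>k\<close> to \<open>\<zeta>\<^bsub>k+1\<^esub>\<close> determines \<open>\<lambda>\<^sub>k\<close>. Both \<open>L\<^sub>n\<close> and all the products \<open>\<zeta>\<^sub>j P\<^sub>j\<close> (with
  \<open>P\<^sub>j\<close> of degree \<open>n - j\<close>) are annihilated by \<open>\<zeta> q u\<close> for \<open>deg q < n - \<nu>\<close>, because the discrete
  part of the Sobolev form vanishes on multiples of \<open>\<zeta>\<close>. Hence, for \<open>k = \<nu>\<close>, the cofactor of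
  \<open>\<zeta>\<close> is orthogonal to all polynomials of degree \<open>< n - \<nu>\<close> with respect to \<open>\<zeta>\<^sup>2 u\<close>, and so is
  a multiple of the last orthogonal polynomial.
\<close>

lemma exists_expansion:
  fixes Q :: "nat \<Rightarrow> 'a::field poly"
  assumes Q: "\<And>n. Q n \<noteq> 0 \<and> degree (Q n) = n"
  shows "degree p \<le> m \<Longrightarrow> \<exists>a. p = (\<Sum>i\<le>m. smult (a i) (Q i))"
proof (induction m arbitrary: p)
  case 0
  obtain b where b: "Q 0 = [:b:]" using Q[of 0] degree_eq_zeroE by blast
  moreover from 0 obtain d where "p = [:d:]" using degree_eq_zeroE by blast
  ultimately have "p = smult (d / b) (Q 0)" using Q[of 0] by auto
  then show ?case by (intro exI[of _ "\<lambda>_. d / b"]) simp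
next
  case (Suc m)
  define d where "d = coeff p (Suc m) / lead_coeff (Q (Suc m))"
  define r where "r = p - smult d (Q (Suc m))"
  have "degree r \<le> m"
  proof (rule degree_le, intro allI impI)
    fix i assume i: "m < i"
    show "coeff r i = 0"
    proof (cases "i = Suc m")
      case True
      have "coeff (Q (Suc m)) (Suc m) \<noteq> 0"
        using Q[of "Suc m"] leading_coeff_neq_0[of "Q (Suc m)"] by simp
      then show ?thesis using True Q[of "Suc m"] by (simp add: r_def d_def)
    next
      case False
      with i have "degree p < i" "degree (Q (Suc m)) < i" using Suc.prems Q[of "Suc m"] by auto
      then show ?thesis by (simp add: r_def coeff_eq_0)
    qed
  qed
  then obtain a where a: "r = (\<Sum>i\<le>m. smult (a i) (Q i))" using Suc.IH by blast
  have "p = r + smult d (Q (Suc m))" by (simp add: r_def)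
  also have "\<dots> = (\<Sum>i\<le>Suc m. smult ((a(Suc m := d)) i) (Q i))"
    by (simp add: a)
  finally show ?case by blast
qed

lemma linear_functionalD:
  assumes "linear_functional u"
  shows "u (p + q) = u p + u q" "u (smult a p) = a * u p" "u (sum f A) = (\<Sum>i\<in>A. u (f i))" "u 0 = 0"
proof -
  interpret Vector_Spaces.linear "smult :: complex \<Rightarrow> _" "(*)" u
    using assms by (simp add: linear_functional_def)
  show "u (p + q) = u p + u q" "u (smult a p) = a * u p" "u (sum f A) = (\<Sum>i\<in>A. u (f i))" "u 0 = 0"
    by (rule add scale sum zero)+
qed

lemma linear_functionalI:
  assumes "\<And>p q. u (p + q) = u p + u q" "\<And>a p. u (smult a p) = a * u p"
  shows "linear_functional u"
  unfolding linear_functional_def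
  by unfold_locales (auto simp: assms algebra_simps smult_add_left smult_add_right)

lemma linear_functional_mult:
  assumes "linear_functional u"
  shows "linear_functional (mult_functional q u)"
  using assms by (intro linear_functionalI)
    (simp_all add: mult_functional_def linear_functionalD distrib_left)

text \<open>By \<open>exists_expansion\<close>, the \<open>Q i\<close> with \<open>i \<le> m\<close>
  span the polynomials of degree at most \<open>m\<close>. It serves for orthogonality relations and
  for the derivative conditions that define \<open>Z\<close>.\<close>

lemma linear_functional_eq_0:
  assumes "linear_functional v" "\<And>n. Q n \<noteq> 0 \<and> degree (Q n) = n"
    and "\<And>i. i \<le> m \<Longrightarrow> v (Q i) = 0" "degree p \<le> m"
  shows "v p = 0"
proof -
  obtain a where "p = (\<Sum>i\<le>m. smult (a i) (Q i))"
    using exists_expansion[of Q, OF assms(2,4)] by blast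
  then show ?thesis using assms(1,3) by (simp add: linear_functionalD)
qed

text \<open>The members of \<open>Q\<close> below index \<open>n\<close> span the polynomials of
  degree below \<open>n\<close>. Stating this for a form \<open>B\<close> covers the Sobolev form,
  which need not depend only on the product of its arguments.\<close>

lemma orthogonal_lower_degree:
  assumes "orthogonal_wrt_form B Q" "linear_functional (B (Q n))" "degree p < n"
  shows "B (Q n) p = 0"
  by (rule linear_functional_eq_0[of "B (Q n)" Q "n - 1"])
    (use assms in \<open>auto simp: orthogonal_wrt_form_def\<close>)

lemma orthogonal_wrt_lower_degree:
  assumes "orthogonal_wrt v Q" "linear_functional v" "degree p < n"
  shows "v (Q n * p) = 0"
  using assms orthogonal_lower_degree[of "\<lambda>f g. v (f * g)" Q n p]
    linear_functional_mult[of v "Q n"]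
  by (simp add: orthogonal_wrt_def mult_functional_def)

text \<open>Pairing the expansion of \<open>p\<close> with \<open>Q k\<close> isolates
  \<open>a k * v (Q k * Q k)\<close>, so every coefficient below index \<open>m\<close>
  vanishes.\<close>

lemma orthogonal_unique:
  assumes orth: "orthogonal_wrt v Q" and lin: "linear_functional v"
    and deg: "degree p \<le> m" and p: "\<And>q. degree q < m \<Longrightarrow> v (p * q) = 0"
  shows "\<exists>a. p = smult a (Q m)"
proof -
  have Q: "\<And>n. Q n \<noteq> 0 \<and> degree (Q n) = n"
    and off: "\<And>n k. k \<noteq> n \<Longrightarrow> v (Q n * Q k) = 0"
    and diag: "\<And>n. v (Q n * Q n) \<noteq> 0"
    using orth by (auto simp: orthogonal_wrt_def orthogonal_wrt_form_def)
  obtain a where a: "p = (\<Sum>i\<le>m. smult (a i) (Q i))" using exists_expansion[of Q, OF Q deg] by blast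
  have zero: "a k = 0" if "k < m" for k
  proof -
    have "v (p * Q k) = (\<Sum>i\<le>m. a i * v (Q i * Q k))"
      by (simp add: a sum_distrib_right linear_functionalD[OF lin])
    also have "\<dots> = (\<Sum>i\<le>m. if i = k then a k * v (Q k * Q k) else 0)"
      by (rule sum.cong) (auto simp: off)
    also have "\<dots> = a k * v (Q k * Q k)" using that by simp
    finally show ?thesis using p[of "Q k"] Q[of k] that diag[of k] by simp
  qed
  have "p = (\<Sum>i\<le>m. if i = m then smult (a m) (Q m) else 0)"
    unfolding a by (rule sum.cong) (auto simp: zero)
  then show ?thesis by auto
qed

lemma linear_functional_deriv_at: "linear_functional (\<lambda>p. deriv_at k p x)"
proof -
  have "(pderiv ^^ k) (p + q) = (pderiv ^^ k) p + (pderiv ^^ k) q"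
    and "(pderiv ^^ k) (smult a p) = smult a ((pderiv ^^ k) p)" for p q :: "complex poly" and a
    by (simp_all add: higher_pderiv_add higher_pderiv_smult)
  then show ?thesis by (intro linear_functionalI) (simp_all add: deriv_at_def)
qed

text \<open>Each differentiation lowers the multiplicity of a root by at most one. The cofactor
  \<open>p\<close> is arbitrary because it changes in the induction step.\<close>

lemma deriv_at_multiple_eq_0: "deriv_at k ([:- of_real x, 1:] ^ Suc k * p) x = 0"
proof (induction k arbitrary: p)
  case 0
  then show ?case by (simp add: deriv_at_def)
next
  case (Suc k)
  let ?s = "[:- of_real x, 1:] :: complex poly"
  \<comment> \<open>An abstract \<open>s\<close> keeps the linear factor from being expanded into
    its coefficients.\<close>
  have "pderiv (s ^ Suc (Suc k) * p) = s ^ Suc k * (smult (of_nat (Suc (Suc k))) p + s * pderiv p)"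
    if "pderiv s = 1" for s :: "complex poly"
    unfolding pderiv_mult pderiv_power_Suc that by (simp add: algebra_simps del: of_nat_Suc)
  from this[of ?s]
  have "pderiv (?s ^ Suc (Suc k) * p) = ?s ^ Suc k * (smult (of_nat (Suc (Suc k))) p + ?s * pderiv p)"
    by (simp add: pderiv_pCons)
  then have "deriv_at (Suc k) (?s ^ Suc (Suc k) * p) x
      = deriv_at k (?s ^ Suc k * (smult (of_nat (Suc (Suc k))) p + ?s * pderiv p)) x"
    unfolding deriv_at_def funpow_Suc_right o_apply by simp
  also have "\<dots> = 0" by (rule Suc.IH)
  finally show ?case .
qed

text \<open>Modulo \<open>X - r\<close>, the polynomial \<open>(X - x)^(k+1)\<close> is the nonzero constant \<open>(r - x)^(k+1)\<close>.\<close>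

lemma deriv_at_cancel_factor:
  assumes f: "\<And>p. deriv_at k ([:- r, 1:] * f * p) x = 0" and r: "r \<noteq> of_real x"
  shows "deriv_at k (f * p) x = 0"
proof -
  let ?s = "[:- of_real x, 1:] ^ Suc k :: complex poly"
  note lin = linear_functionalD[OF linear_functional_deriv_at]
  have "[:- r, 1:] dvd ?s - [:poly ?s r:]"
    by (simp only: poly_eq_0_iff_dvd[symmetric] poly_diff poly_pCons poly_0) simp
  then obtain a where "?s - [:poly ?s r:] = [:- r, 1:] * a" by (elim dvdE)
  then have s: "?s = [:- r, 1:] * a + [:poly ?s r:]" by (metis diff_add_cancel)
  have "?s * (f * p) = [:- r, 1:] * f * (a * p) + smult (poly ?s r) (f * p)"
  proof -
    have "(g * a + [:b:]) * (f * p) = g * f * (a * p) + smult b (f * p)" for g b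
      by (simp add: algebra_simps)
    then show ?thesis by (subst s)
  qed
  \<comment> \<open>The left side vanishes by multiplicity and the first summand by
    \<open>f\<close>, which leaves a nonzero multiple of the wanted value.\<close>
  then have "deriv_at k (?s * (f * p)) x
      = deriv_at k ([:- r, 1:] * f * (a * p)) x + poly ?s r * deriv_at k (f * p) x"
    by (simp only: lin)
  then have "poly ?s r * deriv_at k (f * p) x = 0"
    by (simp only: deriv_at_multiple_eq_0 f add_0)
  moreover have "poly ?s r \<noteq> 0" using r by simp
  ultimately show ?thesis by (metis mult_eq_0_iff)
qed

text \<open>Conjugation fixes every root, hence the monic product \<open>q\<close> of the linear
  factors. Only the leading coefficient changes, which gives the value of \<open>t\<close>.\<close>

lemma map_poly_cnj_real_roots:
  assumes p: "p \<noteq> 0" and roots: "\<And>z. poly p z = 0 \<Longrightarrow> cnj z = z"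
  obtains t where "t \<noteq> 0" "map_poly cnj p = smult t p"
proof
  define q where "q = (\<Prod>z | poly p z = 0. [:- z, 1:] ^ order z p)"
  have pq: "p = smult (lead_coeff p) q"
    using complex_poly_decompose[of p] by (simp add: q_def)
  have q: "cnj (poly q (cnj x)) = poly q x" for x
    unfolding q_def poly_prod cnj_prod
    by (rule prod.cong) (auto simp: roots)
  have "poly (map_poly cnj p) x = poly (smult (cnj (lead_coeff p) / lead_coeff p) p) x" for x
  proof -
    have px: "poly p y = lead_coeff p * poly q y" for y by (subst pq) simp
    show ?thesis using p by (simp add: px q)
  qed
  then show "map_poly cnj p = smult (cnj (lead_coeff p) / lead_coeff p) p"
    by (simp add: poly_eq_poly_eq_iff[symmetric] fun_eq_iff)
  show "cnj (lead_coeff p) / lead_coeff p \<noteq> 0" using p by simp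
qed

lemma degree_1_factor:
  fixes s :: "'a::field poly"
  assumes "degree s = 1"
  obtains b r where "b \<noteq> 0" "s = smult b [:- r, 1:]"
proof -
  from assms obtain a b where "s = [:a, b:]" "b \<noteq> 0" by (rule degree1_coeffs)
  then have "s = smult b [:- (- a / b), 1:]" by simp
  with \<open>b \<noteq> 0\<close> show thesis by (rule that)
qed

theorem proposition3p4:
  fixes \<alpha> :: complex and M :: nat
    and c :: "nat \<Rightarrow> real" and \<mu> :: "nat \<Rightarrow> complex" and \<nu> :: "nat \<Rightarrow> nat"
    and u :: "complex poly \<Rightarrow> complex"
    and L :: "nat \<Rightarrow> complex poly"
    and Z :: "complex poly" and N :: nat
    and \<zeta> :: "nat \<Rightarrow> complex poly"
    and P :: "nat \<Rightarrow> nat \<Rightarrow> complex poly"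
  assumes alpha: "\<forall>k::nat. k \<ge> 1 \<longrightarrow> \<alpha> \<noteq> - of_nat k"
    and M: "M \<ge> 1"
    and nu_mono: "mono_on {1..M} \<nu>"
    and u: "laguerre_functional \<alpha> u"
    and L: "sobolev_laguerre \<alpha> u M \<mu> c \<nu> L"
    and Z: "is_arg_min degree
              (\<lambda>q. q \<noteq> 0 \<and> (\<forall>j\<in>{1..M}. \<forall>n. deriv_at (\<nu> j) (q * L n) (c j) = 0)) Z"
    and N: "N = degree Z"
    and zeta_top: "\<zeta> N = Z"
    and zeta_deg: "\<forall>k\<le>N. \<zeta> k \<noteq> 0 \<and> degree (\<zeta> k) = k"
    and zeta_dvd: "\<forall>k<N. \<zeta> k dvd \<zeta> (Suc k)"
    and P: "\<forall>j\<le>N. orthogonal_wrt (mult_functional (abs_square_poly (\<zeta> j)) u) (P j)"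
    and nonvanishing:
      "\<forall>n\<ge>N. \<forall>j\<in>{1..M}. (\<Prod>k=0..N. poly (P k (n - k)) (complex_of_real (c j))) \<noteq> 0"
  shows "\<forall>n\<ge>N. \<exists>l :: nat \<Rightarrow> complex.
           (\<exists>j\<le>N. l j \<noteq> 0) \<and>
           L n = (\<Sum>j=0..N. smult (l j) (\<zeta> j * P j (n - j)))"
proof (intro allI impI)
  fix n assume n: "n \<ge> N"
  have linu: "linear_functional u" using u by (simp add: laguerre_functional_def)
  note u_simps = linear_functionalD[OF linu]
  have orthL: "orthogonal_wrt_form (sobolev_form u M \<mu> c \<nu>) L"
    using L by (simp add: sobolev_laguerre_def)
  then have Lbasis: "\<And>n. L n \<noteq> 0 \<and> degree (L n) = n" by (auto simp: orthogonal_wrt_form_def)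
  have Z0: "Z \<noteq> 0" and ZL: "\<And>j n. j \<in> {1..M} \<Longrightarrow> deriv_at (\<nu> j) (Z * L n) (c j) = 0"
    and Zmin: "\<And>q. q \<noteq> 0 \<Longrightarrow> \<forall>j\<in>{1..M}. \<forall>n. deriv_at (\<nu> j) (q * L n) (c j) = 0
      \<Longrightarrow> degree Z \<le> degree q"
    using Z by (auto simp: is_arg_min_linorder)
  \<comment> \<open>The \<open>L n\<close> form a basis, so the condition on \<open>Z\<close>
    extends from them to all polynomials.\<close>
  have Zp: "deriv_at (\<nu> j) (Z * p) (c j) = 0" if "j \<in> {1..M}" for j p
    using linear_functional_eq_0[OF linear_functional_mult[OF linear_functional_deriv_at] Lbasis,
        of "degree p" Z "\<nu> j" "c j" p] ZL[OF that]
    by (simp add: mult_functional_def)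

  \<comment> \<open>A root away from all \<open>c j\<close> could be divided out of \<open>Z\<close>
    without losing the derivative conditions, against minimality.\<close>
  have roots: "\<exists>j\<in>{1..M}. r = of_real (c j)" if "poly Z r = 0" for r
  proof (rule ccontr)
    assume *: "\<not> ?thesis"
    from that obtain W where W: "Z = [:- r, 1:] * W"
      by (auto simp: poly_eq_0_iff_dvd elim: dvdE)
    then have "W \<noteq> 0" using Z0 by auto
    moreover have "deriv_at (\<nu> j) (W * L m) (c j) = 0" if "j \<in> {1..M}" for j m
    proof (rule deriv_at_cancel_factor)
      show "deriv_at (\<nu> j) ([:- r, 1:] * W * p) (c j) = 0" for p
        using Zp[OF that, of p] unfolding W .
      show "r \<noteq> of_real (c j)" using * that by blast
    qed
    ultimately have "degree Z \<le> degree W" by (intro Zmin) auto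
    moreover have "degree Z = Suc (degree W)"
      unfolding W using \<open>W \<noteq> 0\<close> by (subst degree_mult_eq) auto
    ultimately show False by simp
  qed

  have zeta_dvd_le: "\<zeta> j dvd \<zeta> k" if "j \<le> k" "k \<le> N" for j k
    using that
  proof (induction k rule: dec_induct)
    case (step i)
    then show ?case using zeta_dvd dvd_trans[of "\<zeta> j" "\<zeta> i" "\<zeta> (Suc i)"] by simp
  qed simp
  have abs_square: "\<exists>t. t \<noteq> 0 \<and> abs_square_poly (\<zeta> k) = smult t (\<zeta> k * \<zeta> k)" if k: "k \<le> N" for k
  proof -
    have "cnj r = r" if r: "poly (\<zeta> k) r = 0" for r
    proof -
      have "poly Z r = 0"
        using r zeta_dvd_le[OF k order_refl] zeta_top by (auto elim: dvdE)
      then show ?thesis using roots by force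
    qed
    then obtain t where "t \<noteq> 0" "map_poly cnj (\<zeta> k) = smult t (\<zeta> k)"
      using map_poly_cnj_real_roots[of "\<zeta> k"] zeta_deg k by blast
    then show ?thesis by (auto simp: abs_square_poly_def)
  qed

  have L_orth: "u (L n * (Z * q)) = 0" if "degree q < n - N" for q
  proof -
    have "degree (Z * q) < n"
      using degree_mult_le[of Z q] that N by linarith
    moreover have "linear_functional (sobolev_form u M \<mu> c \<nu> (L n))"
      by (rule linear_functionalI)
        (simp_all add: sobolev_form_def u_simps linear_functionalD[OF linear_functional_deriv_at]
          algebra_simps sum.distrib sum_distrib_left)
    ultimately have "sobolev_form u M \<mu> c \<nu> (L n) (Z * q) = 0"
      using orthogonal_lower_degree[OF orthL] by blast
    then show ?thesis by (simp add: sobolev_form_def Zp)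
  qed

  have P_orth: "u (\<zeta> k * P k (n - k) * (Z * q)) = 0" if k: "k \<le> N" and q: "degree q < n - N" for k q
  proof -
    \<comment> \<open>One factor \<open>\<zeta> k\<close> of \<open>Z\<close> completes the weight
      \<open>\<zeta> k * \<zeta> k\<close>. The rest, \<open>h\<close>, has degree
      \<open>N - k\<close>, so \<open>h * q\<close> has degree below \<open>n - k\<close>.\<close>
    obtain h where h: "Z = \<zeta> k * h" using zeta_dvd_le[OF k order_refl] zeta_top by (auto elim: dvdE)
    then have "h \<noteq> 0" using Z0 by auto
    moreover have "\<zeta> k \<noteq> 0" "degree (\<zeta> k) = k" using zeta_deg k by blast+
    ultimately have "N = k + degree h" unfolding N h by (simp add: degree_mult_eq)
    then have "degree (h * q) < n - k" using degree_mult_le[of h q] q by linarith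
    then have "mult_functional (abs_square_poly (\<zeta> k)) u (P k (n - k) * (h * q)) = 0"
      using P k linear_functional_mult[OF linu] by (intro orthogonal_wrt_lower_degree) auto
    moreover obtain t where "t \<noteq> 0" "abs_square_poly (\<zeta> k) = smult t (\<zeta> k * \<zeta> k)"
      using abs_square[OF k] by blast
    ultimately have "u (\<zeta> k * \<zeta> k * (P k (n - k) * (h * q))) = 0"
      by (simp add: mult_functional_def u_simps)
    then show ?thesis by (simp add: h mult_ac)
  qed

  have division: "\<exists>l p. L n = (\<Sum>j<k. smult (l j) (\<zeta> j * P j (n - j))) + \<zeta> k * p" if "k \<le> N" for k
    using that
  proof (induction k)
    case 0
    obtain a where "\<zeta> 0 = [:a:]" using zeta_deg degree_eq_zeroE[of "\<zeta> 0"] by blast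
    moreover from this have "a \<noteq> 0" using zeta_deg by auto
    ultimately have "L n = \<zeta> 0 * smult (1 / a) (L n)" by simp
    then have "\<exists>p. L n = \<zeta> 0 * p" by blast
    then show ?case by simp
  next
    case (Suc k)
    then obtain l p where lp: "L n = (\<Sum>j<k. smult (l j) (\<zeta> j * P j (n - j))) + \<zeta> k * p"
      by auto
    obtain s where s: "\<zeta> (Suc k) = \<zeta> k * s" using zeta_dvd Suc.prems by (meson Suc_le_lessD dvdE)
    then have "\<zeta> k \<noteq> 0" "s \<noteq> 0" using zeta_deg Suc.prems by force+
    then have "degree s = 1"
      using zeta_deg Suc.prems degree_mult_eq[of "\<zeta> k" s] s by auto
    then obtain b r where br: "b \<noteq> 0" "s = smult b [:- r, 1:]" by (rule degree_1_factor)
    have "poly Z r = 0"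
      using zeta_dvd_le[OF Suc.prems order_refl] zeta_top s br by (auto elim!: dvdE)
    then obtain j where j: "j \<in> {1..M}" "r = of_real (c j)" using roots by blast
    then have nz: "poly (P k (n - k)) r \<noteq> 0"
      using nonvanishing n Suc.prems by (auto simp: prod_zero_iff)
    \<comment> \<open>This value makes the new remainder vanish at \<open>r\<close>. The denominator
      is nonzero because \<open>r\<close> is one of the points \<open>c j\<close>, where the
      nonvanishing hypothesis applies.\<close>
    define d where "d = poly p r / poly (P k (n - k)) r"
    have "poly (p - smult d (P k (n - k))) r = 0" using nz by (simp add: d_def)
    then have "s dvd p - smult d (P k (n - k))"
      using br by (simp only: poly_eq_0_iff_dvd smult_dvd_iff) simp
    then obtain w where "p - smult d (P k (n - k)) = s * w" by (elim dvdE)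
    then have p: "p = smult d (P k (n - k)) + s * w" by (simp add: algebra_simps)
    have "L n = (\<Sum>j<Suc k. smult ((l(k := d)) j) (\<zeta> j * P j (n - j))) + \<zeta> (Suc k) * w"
      unfolding lp s by (subst p) (simp add: algebra_simps)
    then show ?case by blast
  qed
  then obtain l p where lp: "L n = (\<Sum>j<N. smult (l j) (\<zeta> j * P j (n - j))) + Z * p"
    using zeta_top by blast

  have degP: "degree (P j (n - j)) = n - j" if "j \<le> N" for j
    using P that by (auto simp: orthogonal_wrt_def orthogonal_wrt_form_def)
  \<comment> \<open>Since \<open>j < N \<le> n\<close>, the subtraction is not truncated and the
    degrees \<open>j\<close> and \<open>n - j\<close> add up to \<open>n\<close>.\<close>
  have "degree (smult (l j) (\<zeta> j * P j (n - j))) \<le> n" if "j < N" for j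
    using degree_mult_le[of "\<zeta> j" "P j (n - j)"] degree_smult_le[of "l j" "\<zeta> j * P j (n - j)"]
      zeta_deg degP[of j] that n by fastforce
  then have "degree (\<Sum>j<N. smult (l j) (\<zeta> j * P j (n - j))) \<le> n" by (intro degree_sum_le) auto
  moreover have "Z * p = L n - (\<Sum>j<N. smult (l j) (\<zeta> j * P j (n - j)))" by (simp add: lp)
  ultimately have "degree (Z * p) \<le> n" using Lbasis[of n] by (simp add: degree_diff_le)
  then have deg: "degree p \<le> n - N"
    using Z0 N by (cases "p = 0") (auto simp: degree_mult_eq)

  \<comment> \<open>Subtracting the relations \<open>P_orth\<close> from \<open>L_orth\<close>
    leaves only the term with \<open>Z * p\<close>. For \<open>n = N\<close> the claim is vacuous,
    and \<open>deg\<close> alone makes \<open>p\<close> constant.\<close>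
  have orth: "mult_functional (abs_square_poly Z) u (p * q) = 0" if q: "degree q < n - N" for q
  proof -
    have "u (L n * (Z * q)) = (\<Sum>j<N. l j * u (\<zeta> j * P j (n - j) * (Z * q))) + u (Z * p * (Z * q))"
      by (simp add: lp distrib_right sum_distrib_right u_simps)
    then have "u (Z * p * (Z * q)) = 0" using L_orth[OF q] P_orth[OF _ q] by simp
    then have "u (Z * Z * (p * q)) = 0" by (simp add: mult_ac)
    moreover obtain t where "abs_square_poly Z = smult t (Z * Z)"
      using abs_square[of N] zeta_top by auto
    ultimately show ?thesis by (simp add: mult_functional_def u_simps)
  qed
  have "orthogonal_wrt (mult_functional (abs_square_poly Z) u) (P N)" using P zeta_top by auto
  from orthogonal_unique[OF this linear_functional_mult[OF linu] deg orth]
  obtain d where d: "p = smult d (P N (n - N))" by blast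
  define l' where "l' = l(N := d)"
  have "{0..N} = insert N {..<N}" by auto
  then have eq: "L n = (\<Sum>j=0..N. smult (l' j) (\<zeta> j * P j (n - j)))"
    by (simp add: lp d l'_def zeta_top)
  \<comment> \<open>If all coefficients vanished, so would \<open>L n\<close>, which is
    nonzero.\<close>
  have "\<exists>j\<le>N. l' j \<noteq> 0"
  proof (rule ccontr)
    assume "\<not> ?thesis"
    then have "L n = 0" by (simp add: eq)
    then show False using Lbasis by blast
  qed
  with eq show "\<exists>l. (\<exists>j\<le>N. l j \<noteq> 0) \<and> L n = (\<Sum>j=0..N. smult (l j) (\<zeta> j * P j (n - j)))"
    by blast
qed

end
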